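(* Let $x=\boldsymbol\chi(X)$ be a smooth invertible deformation between regions of $\mathbb R^d$ with smooth inverse, with deformation gradient $F=\nabla_X x$, $J=\det F>0$ and $V^2=FF^t$. Then for every smooth scalar function $p$, $$\nabla_X^2 p = J\,\operatorname{div}\big(J^{-1}V^2\,\nabla p\big).$$
   Context: $X$ denotes points of the undeformed region and $x$ points of the deformed region; $p$ is regarded as a function of $X$ or of $x$ through $x=\boldsymbol\chi(X)$, and likewise $F$, $J$, $V$. $\nabla_X^2$ is the Laplacian in $X$; $\nabla$ and $\operatorname{div}$ are the gradient and divergence in $x$. Components: $F_{iI}=\partial x_i/\partial X_I$. $V$ is the positive definite symmetric square root of $FF^t$. *)

theory Defs
  imports "HOL-Analysis.Analysis"
begin

(* Derivatives are taken "at x" rather than "at x within S", so C_k_on, smooth_on and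
   smooth_diffeo have their usual meaning for open sets only. *)
primrec C_k_on :: "nat \<Rightarrow> 'a::real_normed_vector set \<Rightarrow> ('a \<Rightarrow> 'b::real_normed_vector) \<Rightarrow> bool"
  where
    "C_k_on 0 S f \<longleftrightarrow> continuous_on S f"
  | "C_k_on (Suc k) S f \<longleftrightarrow>
       (\<forall>x\<in>S. f differentiable (at x)) \<and>
       (\<forall>v. C_k_on k S (\<lambda>x. frechet_derivative f (at x) v))"

definition smooth_on :: "'a::real_normed_vector set \<Rightarrow> ('a \<Rightarrow> 'b::real_normed_vector) \<Rightarrow> bool"
  where "smooth_on S f \<longleftrightarrow> (\<forall>k. C_k_on k S f)"

definition smooth_diffeo ::
    "'a::real_normed_vector set \<Rightarrow> 'b::real_normed_vector set \<Rightarrow> ('a \<Rightarrow> 'b) \<Rightarrow> bool"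
  where "smooth_diffeo S T f \<longleftrightarrow>
    bij_betw f S T \<and> smooth_on S f \<and> smooth_on T (inv_into S f)"

definition partial_deriv :: "'n::finite \<Rightarrow> (real^'n \<Rightarrow> real) \<Rightarrow> real^'n \<Rightarrow> real"
  where "partial_deriv i f x = deriv (\<lambda>t. f (x + t *\<^sub>R axis i 1)) 0"

definition gradient :: "(real^'n::finite \<Rightarrow> real) \<Rightarrow> real^'n \<Rightarrow> real^'n"
  where "gradient f x = (\<chi> i. partial_deriv i f x)"

definition divergence :: "(real^'n::finite \<Rightarrow> real^'n) \<Rightarrow> real^'n \<Rightarrow> real"
  where "divergence u x = (\<Sum>i\<in>UNIV. partial_deriv i (\<lambda>y. u y $ i) x)"

definition laplacian :: "(real^'n::finite \<Rightarrow> real) \<Rightarrow> real^'n \<Rightarrow> real"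
  where "laplacian f x = (\<Sum>i\<in>UNIV. partial_deriv i (partial_deriv i f) x)"

definition sym_pos_def :: "real^'n::finite^'n \<Rightarrow> bool"
  where "sym_pos_def A \<longleftrightarrow> transpose A = A \<and> (\<forall>v. v \<noteq> 0 \<longrightarrow> v \<bullet> (A *v v) > 0)"

end

theory Submission
  imports Defs
begin

text \<open>Since \<open>V\<^sup>2 = F F\<^sup>t\<close> and \<open>F\<^sup>t \<nabla>p\<close> is the gradient of \<open>p\<close> in \<open>X\<close>, the
  vector field under the divergence is \<open>J\<^sup>-\<^sup>1 F \<nabla>\<^sub>X p\<close>. The columns of \<open>J\<^sup>-\<^sup>1 F\<close> are
  divergence free in \<open>x\<close>, by Jacobi's formula for the derivative of \<open>det F\<close> and the
  symmetry of the second derivatives of the deformation. So only the derivatives of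
  \<open>\<nabla>\<^sub>X p\<close> survive, and these give \<open>J\<^sup>-\<^sup>1 \<nabla>\<^sub>X\<^sup>2 p\<close> by the chain rule.\<close>

section \<open>Symmetry of second derivatives\<close>

text \<open>Two uses of the mean value theorem, first along \<open>u\<close> and then along
  \<open>v\<close>, turn the second difference over the parallelogram with sides
  \<open>h *\<^sub>R u\<close> and \<open>h *\<^sub>R v\<close> into a mixed derivative. That
  difference is symmetric in \<open>u\<close> and \<open>v\<close>, so taking the directions in
  either order compares the two mixed derivatives.\<close>

lemma mixed_difference_MVT:
  fixes f :: "'a::real_normed_vector \<Rightarrow> real"
  assumes h: "0 < h"
    and S: "\<And>s t. \<lbrakk>0 \<le> s; s \<le> h; 0 \<le> t; t \<le> h\<rbrakk> \<Longrightarrow> x + s *\<^sub>R u + t *\<^sub>R v \<in> S"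
    and f': "\<And>y. y \<in> S \<Longrightarrow> (f has_derivative f' y) (at y)"
    and g: "\<And>y. y \<in> S \<Longrightarrow> ((\<lambda>y. f' y u) has_derivative g y) (at y)"
  obtains \<xi> \<eta> where "0 < \<xi>" "\<xi> < h" "0 < \<eta>" "\<eta> < h"
    "f (x + h *\<^sub>R u + h *\<^sub>R v) - f (x + h *\<^sub>R u) - f (x + h *\<^sub>R v) + f x
      = h * h * g (x + \<xi> *\<^sub>R u + \<eta> *\<^sub>R v) v"
proof -
  have line: "((\<lambda>s. k (a + s *\<^sub>R w)) has_real_derivative k' w) (at s)"
    if k: "(k has_derivative k') (at (a + s *\<^sub>R w))" for k :: "'a \<Rightarrow> real" and k' a w s
  proof -
    have "((\<lambda>s. a + s *\<^sub>R w) has_derivative (\<lambda>r. r *\<^sub>R w)) (at s)"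
      by (auto intro!: derivative_eq_intros)
    from has_derivative_compose[OF this k]
    have "((\<lambda>s. k (a + s *\<^sub>R w)) has_derivative (\<lambda>r. k' (r *\<^sub>R w))) (at s)" .
    moreover have "(\<lambda>r. k' (r *\<^sub>R w)) = (*) (k' w)"
      using has_derivative_linear[OF k] by (auto simp: linear_cmul)
    ultimately show ?thesis
      by (simp add: has_field_derivative_def)
  qed
  \<comment> \<open>The second difference is \<open>\<phi> h - \<phi> 0\<close>: each value of
    \<open>\<phi>\<close> is an increment of \<open>f\<close> along
    \<open>h *\<^sub>R v\<close>.\<close>
  define \<phi> where "\<phi> s = f (x + h *\<^sub>R v + s *\<^sub>R u) - f (x + s *\<^sub>R u)" for s
  have "(\<phi> has_real_derivative
      f' (x + h *\<^sub>R v + s *\<^sub>R u) u - f' (x + s *\<^sub>R u) u) (at s)"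
    if "0 \<le> s" "s \<le> h" for s
    unfolding \<phi>_def using S[of s h] S[of s 0] that h
    by (intro DERIV_diff line f') (auto simp: algebra_simps)
  from MVT2[OF h this] obtain \<xi> where \<xi>: "0 < \<xi>" "\<xi> < h"
    "\<phi> h - \<phi> 0 = h * (f' (x + h *\<^sub>R v + \<xi> *\<^sub>R u) u - f' (x + \<xi> *\<^sub>R u) u)"
    by auto
  have "((\<lambda>t. f' (x + \<xi> *\<^sub>R u + t *\<^sub>R v) u) has_real_derivative
      g (x + \<xi> *\<^sub>R u + t *\<^sub>R v) v) (at t)" if "0 \<le> t" "t \<le> h" for t
    using S[of \<xi> t] that \<xi> by (intro line[where k = "\<lambda>y. f' y u"] g) auto
  from MVT2[OF h this] obtain \<eta> where \<eta>: "0 < \<eta>" "\<eta> < h"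
    "f' (x + \<xi> *\<^sub>R u + h *\<^sub>R v) u - f' (x + \<xi> *\<^sub>R u) u
      = h * g (x + \<xi> *\<^sub>R u + \<eta> *\<^sub>R v) v"
    by auto
  show ?thesis
    using that[OF \<xi>(1,2) \<eta>(1,2)] \<xi>(3) \<eta>(3) by (simp add: \<phi>_def algebra_simps)
qed

text \<open>On a small parallelogram the same second difference yields a value of \<open>g\<close>
  and a value of \<open>k\<close> that coincide, though at different points near \<open>x\<close>.
  By continuity each is within \<open>e\<close> of its value at \<open>x\<close>, and
  \<open>e\<close> is half the supposed gap.\<close>

lemma second_derivative_symmetric:
  fixes f :: "'a::real_normed_vector \<Rightarrow> real"
  assumes S: "open S" "x \<in> S"
    and f': "\<And>y. y \<in> S \<Longrightarrow> (f has_derivative f' y) (at y)"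
    and g: "\<And>y. y \<in> S \<Longrightarrow> ((\<lambda>y. f' y u) has_derivative g y) (at y)"
    and k: "\<And>y. y \<in> S \<Longrightarrow> ((\<lambda>y. f' y v) has_derivative k y) (at y)"
    and cont: "continuous_on S (\<lambda>y. g y v)" "continuous_on S (\<lambda>y. k y u)"
  shows "g x v = k x u"
proof (rule ccontr)
  assume neq: "g x v \<noteq> k x u"
  define e where "e = \<bar>g x v - k x u\<bar> / 2"
  have e: "0 < e" using neq by (simp add: e_def)
  obtain r where r: "0 < r" "ball x r \<subseteq> S"
    using S by (auto simp: open_contains_ball)
  obtain d1 where d1: "0 < d1" "\<And>y. y \<in> S \<Longrightarrow> dist y x < d1 \<Longrightarrow> dist (g y v) (g x v) < e"
    using cont(1) S(2) e unfolding continuous_on_iff by metis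
  obtain d2 where d2: "0 < d2" "\<And>y. y \<in> S \<Longrightarrow> dist y x < d2 \<Longrightarrow> dist (k y u) (k x u) < e"
    using cont(2) S(2) e unfolding continuous_on_iff by metis
  define d where "d = min r (min d1 d2)"
  \<comment> \<open>This size keeps the whole parallelogram within distance \<open>d\<close> of
    \<open>x\<close>. The summand 1 covers \<open>u = v = 0\<close> and makes the estimate
    strict.\<close>
  define h where "h = d / (norm u + norm v + 1)"
  have pos: "0 < norm u + norm v + 1"
    using norm_ge_zero[of u] norm_ge_zero[of v] by linarith
  have d: "0 < d" using r d1 d2 by (simp add: d_def)
  then have h: "0 < h" using pos by (simp add: h_def)
  have near: "dist (x + s *\<^sub>R u + t *\<^sub>R v) x < d" if "0 \<le> s" "s \<le> h" "0 \<le> t" "t \<le> h" for s t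
  proof -
    have "norm (s *\<^sub>R u + t *\<^sub>R v) \<le> s * norm u + t * norm v"
      using norm_triangle_ineq[of "s *\<^sub>R u" "t *\<^sub>R v"] that by simp
    also have "\<dots> \<le> h * norm u + h * norm v"
      using that by (intro add_mono mult_right_mono) auto
    also have "\<dots> < h * (norm u + norm v + 1)"
      using h by (simp add: algebra_simps)
    also have "\<dots> = d" using pos by (simp add: h_def)
    finally show ?thesis by (simp add: dist_norm add.assoc)
  qed
  have inS: "x + s *\<^sub>R u + t *\<^sub>R v \<in> S" if "0 \<le> s" "s \<le> h" "0 \<le> t" "t \<le> h" for s t
    using near[OF that] r(2) by (auto simp: d_def dist_commute)
  have inS': "x + s *\<^sub>R v + t *\<^sub>R u \<in> S" if "0 \<le> s" "s \<le> h" "0 \<le> t" "t \<le> h" for s t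
    using inS[of t s] that by (simp add: algebra_simps)
  obtain a b where ab: "0 < a" "a < h" "0 < b" "b < h"
    "f (x + h *\<^sub>R u + h *\<^sub>R v) - f (x + h *\<^sub>R u) - f (x + h *\<^sub>R v) + f x
      = h * h * g (x + a *\<^sub>R u + b *\<^sub>R v) v"
    using mixed_difference_MVT[OF h inS f' g] by blast
  obtain a' b' where ab': "0 < a'" "a' < h" "0 < b'" "b' < h"
    "f (x + h *\<^sub>R v + h *\<^sub>R u) - f (x + h *\<^sub>R v) - f (x + h *\<^sub>R u) + f x
      = h * h * k (x + a' *\<^sub>R v + b' *\<^sub>R u) u"
    using mixed_difference_MVT[OF h inS' f' k] by blast
  have "h * h * g (x + a *\<^sub>R u + b *\<^sub>R v) v = h * h * k (x + b' *\<^sub>R u + a' *\<^sub>R v) u"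
    using ab(5) ab'(5) by (simp add: algebra_simps)
  then have "g (x + a *\<^sub>R u + b *\<^sub>R v) v = k (x + b' *\<^sub>R u + a' *\<^sub>R v) u"
    using h by simp
  moreover have "dist (g (x + a *\<^sub>R u + b *\<^sub>R v) v) (g x v) < e"
    using ab near[of a b] inS[of a b] by (intro d1(2)) (auto simp: d_def)
  moreover have "dist (k (x + b' *\<^sub>R u + a' *\<^sub>R v) u) (k x u) < e"
    using ab' near[of b' a'] inS[of b' a'] by (intro d2(2)) (auto simp: d_def)
  ultimately show False by (simp add: e_def dist_real_def abs_if split: if_splits)
qed

section \<open>Jacobi's formula\<close>

text \<open>Differentiating the Leibniz expansion gives a sum of determinants, each with one row of
  \<open>A x\<close> replaced by the same row of \<open>A' h\<close>. Cramer's rule evaluates them,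
  the new row being a combination of the rows of \<open>A x\<close>. As \<open>B\<close> inverts
  \<open>A x\<close>, \<open>det (A x)\<close> times \<open>B\<close> is the adjugate.\<close>

lemma has_derivative_det:
  fixes A :: "'a::real_normed_vector \<Rightarrow> real^'n^'n"
  assumes A: "(A has_derivative A') (at x)" and B: "B ** A x = mat 1"
  shows "((\<lambda>y. det (A y)) has_derivative (\<lambda>h. det (A x) * trace (A' h ** B))) (at x)"
proof -
  have entry: "((\<lambda>y. A y $ i $ j) has_derivative (\<lambda>h. A' h $ i $ j)) (at x)" for i j
    by (intro bounded_linear.has_derivative[OF bounded_linear_vec_nth] A)
  define P where "P = {p :: 'n \<Rightarrow> 'n. p permutes UNIV}"
  have "((\<lambda>y. \<Sum>p\<in>P. of_int (sign p) * (\<Prod>i\<in>UNIV. A y $ i $ p i)) has_derivative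
      (\<lambda>h. \<Sum>p\<in>P. of_int (sign p) *
         (\<Sum>k\<in>UNIV. A' h $ k $ p k * (\<Prod>i\<in>UNIV-{k}. A x $ i $ p i)))) (at x)"
    by (intro has_derivative_sum has_derivative_mult_right has_derivative_prod entry)
  moreover have "(\<Sum>p\<in>P. of_int (sign p) *
         (\<Sum>k\<in>UNIV. A' h $ k $ p k * (\<Prod>i\<in>UNIV-{k}. A x $ i $ p i)))
      = det (A x) * trace (A' h ** B)" for h
  proof -
    let ?C = "A' h ** B"
    \<comment> \<open>The coefficients of row \<open>k\<close> of \<open>A' h\<close> in the rows of
      \<open>A x\<close> form row \<open>k\<close> of \<open>?C\<close>. Cramer's rule picks out the
      diagonal one, whence the trace.\<close>
    have C: "(\<Sum>i\<in>UNIV. ?C $ k $ i *s row i (A x)) = row k (A' h)" for k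
    proof -
      have "?C ** A x = A' h"
        by (simp add: matrix_mul_assoc[symmetric] B)
      moreover have "(\<Sum>i\<in>UNIV. ?C $ k $ i *s row i (A x)) = row k (?C ** A x)"
        by (simp add: vec_eq_iff row_def matrix_matrix_mult_def)
      ultimately show ?thesis by simp
    qed
    have "(\<Sum>p\<in>P. of_int (sign p) *
         (\<Sum>k\<in>UNIV. A' h $ k $ p k * (\<Prod>i\<in>UNIV-{k}. A x $ i $ p i)))
       = (\<Sum>k\<in>UNIV. \<Sum>p\<in>P. of_int (sign p) *
         (A' h $ k $ p k * (\<Prod>i\<in>UNIV-{k}. A x $ i $ p i)))"
      unfolding sum_distrib_left by (rule sum.swap)
    also have "\<dots> = (\<Sum>k\<in>UNIV. det ((\<chi> i. if i = k then row k (A' h) else row i (A x)) :: real^'n^'n))"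
      unfolding det_def P_def
    proof (intro sum.cong refl arg_cong2[where f = "(*)"])
      fix k p
      show "A' h $ k $ p k * (\<Prod>i\<in>UNIV-{k}. A x $ i $ p i)
        = (\<Prod>i\<in>UNIV. ((\<chi> i. if i = k then row k (A' h) else row i (A x)) :: real^'n^'n) $ i $ p i)"
        by (subst (2) prod.remove[of _ k]) (auto simp: row_def intro!: prod.cong)
    qed
    also have "\<dots> = (\<Sum>k\<in>UNIV. ?C $ k $ k * det (A x))"
      using cramer_lemma_transpose[of _ "?C $ _" "A x", unfolded C] by (intro sum.cong) simp_all
    finally show ?thesis
      by (simp add: trace_def sum_distrib_left mult.commute)
  qed
  ultimately show ?thesis
    unfolding det_def P_def by simp
qed

section \<open>Coordinates and changes of variable\<close>

lemma partial_deriv_eqI: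
  assumes f: "(f has_derivative f') (at x)"
  shows "partial_deriv i f x = f' (axis i 1)"
proof -
  have "((\<lambda>t. x + t *\<^sub>R axis i 1) has_derivative (\<lambda>r. r *\<^sub>R axis i 1)) (at 0)"
    by (auto intro!: derivative_eq_intros)
  from has_derivative_compose[OF this, of f f'] f
  have "((\<lambda>t. f (x + t *\<^sub>R axis i 1)) has_derivative (\<lambda>r. f' (r *\<^sub>R axis i 1))) (at 0)"
    by simp
  moreover have "(\<lambda>r. f' (r *\<^sub>R axis i 1)) = (*) (f' (axis i 1))"
    using has_derivative_linear[OF f] by (auto simp: linear_cmul)
  ultimately show ?thesis
    unfolding partial_deriv_def by (intro DERIV_imp_deriv) (simp add: has_field_derivative_def)
qed

lemma linear_axis_expansion:
  fixes f :: "real^'n \<Rightarrow> 'b::real_vector"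
  assumes "linear f"
  shows "f v = (\<Sum>i\<in>UNIV. (v $ i) *\<^sub>R f (axis i 1))"
proof -
  have "f v = f (\<Sum>i\<in>UNIV. (v $ i) *\<^sub>R axis i 1)"
    using basis_expansion[of v] by (simp add: scalar_mult_eq_scaleR)
  then show ?thesis
    using assms by (simp add: linear_sum linear_cmul)
qed

text \<open>This is the chain rule in coordinates. With \<open>A\<close> the derivative of the
  deformation and \<open>G\<close> that of its inverse, \<open>f (G *v axis i 1)\<close> is a
  derivative along \<open>x\<close> coordinate \<open>i\<close>, and weighting by column
  \<open>j\<close> of \<open>A\<close> gives back the one along \<open>X\<close> coordinate
  \<open>j\<close>.\<close>

lemma sum_linear_left_inverse:
  fixes f :: "real^'n \<Rightarrow> 'b::real_vector" and A G :: "real^'n^'n"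
  assumes f: "linear f" and GA: "G ** A = mat 1"
  shows "(\<Sum>i\<in>UNIV. (A $ i $ j) *\<^sub>R f (G *v axis i 1)) = f (axis j 1)"
proof -
  have "linear (f \<circ> (*v) G)"
    by (intro linear_compose f) simp
  from linear_axis_expansion[OF this, of "A *v axis j 1"]
  have "f (G *v (A *v axis j 1)) = (\<Sum>i\<in>UNIV. ((A *v axis j 1) $ i) *\<^sub>R f (G *v axis i 1))"
    by (simp only: o_def)
  moreover have "G *v (A *v axis j 1) = axis j 1"
    by (simp only: matrix_vector_mul_assoc GA matrix_vector_mul_lid)
  moreover have "(A *v axis j 1) $ i = A $ i $ j" for i
    by (simp add: matrix_vector_mult_basis column_def)
  ultimately show ?thesis by simp
qed

lemma smooth_on_has_derivative:
  assumes "smooth_on S f" "x \<in> S"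
  shows "(f has_derivative frechet_derivative f (at x)) (at x)"
  using assms by (metis C_k_on.simps(2) smooth_on_def frechet_derivative_works)

lemma smooth_on_frechet_derivative:
  assumes "smooth_on S f"
  shows "smooth_on S (\<lambda>x. frechet_derivative f (at x) v)"
  using assms by (metis C_k_on.simps(2) smooth_on_def)

lemma smooth_on_imp_continuous_on:
  assumes "smooth_on S f"
  shows "continuous_on S f"
  using assms by (metis C_k_on.simps(1) smooth_on_def)

text \<open>The Piola identity \<open>\<Sum>i. \<partial>(J\<^sup>-\<^sup>1 F i I)/\<partial>x i = 0\<close>, the \<open>x\<close>-derivatives being
  written as \<open>X\<close>-derivatives in the directions \<open>G *v axis i 1\<close>, with \<open>G\<close> the inverse of \<open>F\<close>.\<close>
lemma piola_identity:
  fixes chi :: "real^'n \<Rightarrow> real^'n"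
  defines "F \<equiv> \<lambda>Y. jacobian chi (at Y)"
  assumes S: "open S" "X \<in> S" and chi: "smooth_on S chi"
    and GF: "G ** F X = mat 1"
  obtains c' where
    "\<And>i I. ((\<lambda>Y. inverse (det (F Y)) * F Y $ i $ I) has_derivative c' i I) (at X)"
    "\<And>I. (\<Sum>i\<in>UNIV. c' i I (G *v axis i 1)) = 0"
proof -
  \<comment> \<open>\<open>D I\<close> is column \<open>I\<close> of \<open>F\<close>, so
    \<open>D2 I X (axis K 1)\<close> collects the second partial derivatives in the directions
    \<open>I\<close> and \<open>K\<close>.\<close>
  define D where "D I Y = frechet_derivative chi (at Y) (axis I 1)" for I Y
  define D2 where "D2 I Y = frechet_derivative (D I) (at Y)" for I Y
  define F' where "F' w = (\<chi> i I. D2 I X w $ i)" for w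
  define T where "T w = det (F X) * trace (F' w ** G)" for w
  have D: "smooth_on S (D I)" for I
    unfolding D_def using smooth_on_frechet_derivative[OF chi] .
  have dD: "(D I has_derivative D2 I Y) (at Y)" if "Y \<in> S" for I Y
    unfolding D2_def using smooth_on_has_derivative[OF D that] .
  have F_entry: "F Y $ i $ I = D I Y $ i" for Y i I
    by (simp add: F_def D_def jacobian_def matrix_def)
  have dF_entry: "((\<lambda>Y. F Y $ i $ I) has_derivative (\<lambda>w. F' w $ i $ I)) (at X)" for i I
    unfolding F_entry F'_def using dD[OF S(2)]
    by (auto intro: bounded_linear.has_derivative[OF bounded_linear_vec_nth])
  then have dF: "(F has_derivative F') (at X)"
    by (subst has_derivative_componentwise_within) (auto simp: Basis_vec_def inner_axis)
  have symm: "D2 I X (axis K 1) $ i = D2 K X (axis I 1) $ i" for i I K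
  proof (rule second_derivative_symmetric[OF S, where f = "\<lambda>y. chi y $ i"
        and f' = "\<lambda>y w. frechet_derivative chi (at y) w $ i"
        and g = "\<lambda>y w. D2 I y w $ i" and k = "\<lambda>y w. D2 K y w $ i"])
    fix y assume "y \<in> S"
    note vec_nth_deriv = bounded_linear.has_derivative[OF bounded_linear_vec_nth]
    show "((\<lambda>y. chi y $ i) has_derivative (\<lambda>w. frechet_derivative chi (at y) w $ i)) (at y)"
      by (intro vec_nth_deriv smooth_on_has_derivative[OF chi \<open>y \<in> S\<close>])
    show "((\<lambda>y. frechet_derivative chi (at y) (axis I 1) $ i) has_derivative (\<lambda>w. D2 I y w $ i)) (at y)"
      using dD[OF \<open>y \<in> S\<close>, of I] unfolding D_def by (rule vec_nth_deriv)
    show "((\<lambda>y. frechet_derivative chi (at y) (axis K 1) $ i) has_derivative (\<lambda>w. D2 K y w $ i)) (at y)"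
      using dD[OF \<open>y \<in> S\<close>, of K] unfolding D_def by (rule vec_nth_deriv)
  next
    show "continuous_on S (\<lambda>y. D2 I y (axis K 1) $ i)" "continuous_on S (\<lambda>y. D2 K y (axis I 1) $ i)"
      unfolding D2_def
      by (intro continuous_on_component smooth_on_imp_continuous_on smooth_on_frechet_derivative D)+
  qed
  have dJ: "((\<lambda>Y. det (F Y)) has_derivative T) (at X)"
    unfolding T_def using has_derivative_det[OF dF GF] .
  have "det G * det (F X) = 1"
    using arg_cong[OF GF, of det] by (simp add: det_mul)
  then have J: "det (F X) \<noteq> 0" by auto
  \<comment> \<open>The product rule for the inverse of \<open>det F\<close> times an entry of
    \<open>F\<close>, with \<open>T\<close> the derivative of \<open>det F\<close>.\<close>
  define c' where "c' i I w = inverse (det (F X)) * (F' w $ i $ I)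
    - inverse (det (F X)) * T w * inverse (det (F X)) * F X $ i $ I" for i I w
  have "((\<lambda>Y. inverse (det (F Y)) * F Y $ i $ I) has_derivative c' i I) (at X)" for i I
    unfolding c'_def
    by (rule has_derivative_eq_rhs[OF has_derivative_mult[OF Deriv.has_derivative_inverse[OF J dJ] dF_entry]])
      (auto simp: fun_eq_iff)
  moreover have "(\<Sum>i\<in>UNIV. c' i I (G *v axis i 1)) = 0" for I
  proof -
    have T: "(\<Sum>i\<in>UNIV. F X $ i $ I * T (G *v axis i 1)) = T (axis I 1)"
      using sum_linear_left_inverse[OF has_derivative_linear[OF dJ] GF, of I]
      by (simp only: real_scaleR_def)
    \<comment> \<open>Symmetry exchanges the column index \<open>I\<close> with the direction
      \<open>K\<close> of differentiation. Summed over \<open>i\<close>, this becomes the same trace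
      that Jacobi's formula puts into \<open>T (axis I 1)\<close>, so the two halves of
      \<open>c'\<close> cancel.\<close>
    have "F' (G *v axis i 1) $ i $ I = (\<Sum>K\<in>UNIV. F' (axis I 1) $ i $ K * G $ K $ i)" for i
    proof -
      have "linear (\<lambda>w. F' w $ i $ I)"
        using has_derivative_linear[OF dF_entry] .
      from linear_axis_expansion[OF this, of "G *v axis i 1"] show ?thesis
        by (simp add: F'_def symm[of I] matrix_vector_mult_basis column_def mult.commute)
    qed
    then have "(\<Sum>i\<in>UNIV. F' (G *v axis i 1) $ i $ I) = trace (F' (axis I 1) ** G)"
      by (simp add: trace_def matrix_matrix_mult_def)
    then show ?thesis
      using T J by (simp add: c'_def sum_subtractf sum_distrib_left[symmetric] mult.assoc)
        (simp add: T_def field_simps sum_distrib_left[symmetric])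
  qed
  ultimately show thesis using that by blast
qed

section \<open>Transformation of the Laplacian\<close>

theorem lemma1:
  fixes \<Omega>\<^sub>0 \<Omega> :: "(real^'n) set"
    and chi :: "real^'n \<Rightarrow> real^'n"
    and F V :: "real^'n \<Rightarrow> real^'n^'n"
    and J :: "real^'n \<Rightarrow> real"
    and p :: "real^'n \<Rightarrow> real"
  assumes "open \<Omega>\<^sub>0" and "open \<Omega>"
    and "smooth_diffeo \<Omega>\<^sub>0 \<Omega> chi"
    and "\<And>X. X \<in> \<Omega>\<^sub>0 \<Longrightarrow> F X = jacobian chi (at X)"
    and "\<And>X. X \<in> \<Omega>\<^sub>0 \<Longrightarrow> J X = det (F X)"
    and "\<And>X. X \<in> \<Omega>\<^sub>0 \<Longrightarrow> J X > 0"
    and "\<And>X. X \<in> \<Omega>\<^sub>0 \<Longrightarrow> sym_pos_def (V X)"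
    and "\<And>X. X \<in> \<Omega>\<^sub>0 \<Longrightarrow> V X ** V X = F X ** transpose (F X)"
    and "smooth_on \<Omega> p"
    and "X \<in> \<Omega>\<^sub>0"
  shows "laplacian (p \<circ> chi) X =
    J X * divergence
      (\<lambda>x. let Y = inv_into \<Omega>\<^sub>0 chi x in inverse (J Y) *\<^sub>R ((V Y ** V Y) *v gradient p x)) (chi X)"
proof -
  note S = assms(1) and T = assms(2) and F = assms(4) and J = assms(5) and VV = assms(8)
    and p = assms(9) and X = assms(10)
  define \<psi> where "\<psi> = inv_into \<Omega>\<^sub>0 chi"
  have bij: "bij_betw chi \<Omega>\<^sub>0 \<Omega>" and chi: "smooth_on \<Omega>\<^sub>0 chi" and \<psi>: "smooth_on \<Omega> \<psi>"
    using assms(3) by (auto simp: smooth_diffeo_def \<psi>_def)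
  have chi_in: "chi Y \<in> \<Omega>" if "Y \<in> \<Omega>\<^sub>0" for Y using bij that by (auto simp: bij_betw_def)
  have \<psi>_in: "\<psi> x \<in> \<Omega>\<^sub>0" if "x \<in> \<Omega>" for x
    using bij that unfolding \<psi>_def by (metis bij_betw_def inv_into_into)
  have chi_\<psi>: "chi (\<psi> x) = x" if "x \<in> \<Omega>" for x
    using bij_betw_inv_into_right[OF bij that] by (simp add: \<psi>_def)
  have \<psi>_chi: "\<psi> (chi Y) = Y" if "Y \<in> \<Omega>\<^sub>0" for Y
    using bij_betw_inv_into_left[OF bij that] by (simp add: \<psi>_def)
  have dchi: "(chi has_derivative (*v) (F Y)) (at Y)" if "Y \<in> \<Omega>\<^sub>0" for Y
    using smooth_on_has_derivative[OF chi that] F[OF that]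
    by (metis jacobian_works differentiable_def)
  define G where "G = jacobian \<psi> (at (chi X))"
  have d\<psi>: "(\<psi> has_derivative (*v) G) (at (chi X))"
    using smooth_on_has_derivative[OF \<psi> chi_in[OF X]] unfolding G_def
    by (metis jacobian_works differentiable_def)
  \<comment> \<open>Differentiating \<open>\<psi> (chi Y) = Y\<close>, valid on the open set around
    \<open>X\<close>, shows that \<open>G\<close> inverts \<open>F X\<close>.\<close>
  have "((\<lambda>Y. \<psi> (chi Y)) has_derivative (\<lambda>h. G *v (F X *v h))) (at X)"
    using has_derivative_compose[OF dchi[OF X] d\<psi>] .
  then have "((\<lambda>Y. Y) has_derivative (\<lambda>h. G *v (F X *v h))) (at X)"
    by (rule has_derivative_transform_within_open[OF _ S X \<psi>_chi])
  then have "(\<lambda>h. G *v (F X *v h)) = (\<lambda>h. h)"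
    using has_derivative_unique has_derivative_ident by blast
  then have GF: "G ** F X = mat 1"
    by (simp add: matrix_eq matrix_vector_mul_assoc fun_eq_iff)
  obtain c' where c':
    "\<And>i I. ((\<lambda>Y. inverse (det (jacobian chi (at Y))) * jacobian chi (at Y) $ i $ I)
      has_derivative c' i I) (at X)"
    "\<And>I. (\<Sum>i\<in>UNIV. c' i I (G *v axis i 1)) = 0"
    using piola_identity[OF S X chi GF[unfolded F[OF X]]] by blast
  \<comment> \<open>\<open>J\<close> and \<open>F\<close> are prescribed on
    \<open>\<Omega>\<^sub>0\<close> only; agreement on this open set is enough for derivatives at
    \<open>X\<close>.\<close>
  have dc: "((\<lambda>Y. inverse (J Y) * F Y $ i $ I) has_derivative c' i I) (at X)" for i I
    by (rule has_derivative_transform_within_open[OF c'(1) S X]) (simp add: F J)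
  define q where "q I = partial_deriv I (p \<circ> chi)" for I
  have grad: "gradient p (chi Y) $ i = frechet_derivative p (at (chi Y)) (axis i 1)"
    if "Y \<in> \<Omega>\<^sub>0" for Y i
    using partial_deriv_eqI[OF smooth_on_has_derivative[OF p chi_in[OF that]]]
    by (simp add: gradient_def)
  have q: "q I Y = (\<Sum>i\<in>UNIV. F Y $ i $ I * gradient p (chi Y) $ i)" if "Y \<in> \<Omega>\<^sub>0" for I Y
  proof -
    note dp = smooth_on_has_derivative[OF p chi_in[OF that]]
    have "q I Y = frechet_derivative p (at (chi Y)) (F Y *v axis I 1)"
      unfolding q_def using has_derivative_compose[OF dchi[OF that] dp]
      by (intro partial_deriv_eqI) (simp add: o_def)
    then show ?thesis
      using linear_axis_expansion[OF has_derivative_linear[OF dp], of "F Y *v axis I 1"] grad[OF that]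
      by (simp add: matrix_vector_mult_basis column_def)
  qed
  \<comment> \<open>\<open>q I\<close> is defined by \<open>deriv\<close>, which has a value even
    where no derivative exists. Differentiability is read off from the chain rule expression
    \<open>?f\<close>, built from smooth functions.\<close>
  have "q I differentiable at X" for I
  proof -
    let ?f = "\<lambda>Y. \<Sum>i\<in>UNIV. frechet_derivative chi (at Y) (axis I 1) $ i *
      frechet_derivative p (at (chi Y)) (axis i 1)"
    have "?f differentiable at X"
    proof (intro differentiable_sum differentiable_mult finite ballI)
      fix i
      show "(\<lambda>Y. frechet_derivative chi (at Y) (axis I 1) $ i) differentiable at X"
        using bounded_linear.has_derivative[OF bounded_linear_vec_nth
          smooth_on_has_derivative[OF smooth_on_frechet_derivative[OF chi] X]]
        unfolding differentiable_def by blast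
      show "(\<lambda>Y. frechet_derivative p (at (chi Y)) (axis i 1)) differentiable at X"
        using has_derivative_compose[OF dchi[OF X]
          smooth_on_has_derivative[OF smooth_on_frechet_derivative[OF p] chi_in[OF X]]]
        unfolding differentiable_def by blast
    qed
    then obtain f' where "(?f has_derivative f') (at X)" unfolding differentiable_def by blast
    then have "(q I has_derivative f') (at X)"
      by (rule has_derivative_transform_within_open[OF _ S X])
        (simp add: q grad F jacobian_def matrix_def)
    then show ?thesis unfolding differentiable_def by blast
  qed
  then obtain q' where q': "\<And>I. (q I has_derivative q' I) (at X)"
    unfolding differentiable_def by metis
  let ?u = "\<lambda>x. let Y = inv_into \<Omega>\<^sub>0 chi x in inverse (J Y) *\<^sub>R ((V Y ** V Y) *v gradient p x)"
  have u: "?u x $ i = (\<Sum>I\<in>UNIV. (inverse (J (\<psi> x)) * F (\<psi> x) $ i $ I) * q I (\<psi> x))"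
    if "x \<in> \<Omega>" for x i
  proof -
    define Y where "Y = \<psi> x"
    have Y: "Y \<in> \<Omega>\<^sub>0" "chi Y = x" using that by (auto simp: Y_def \<psi>_in chi_\<psi>)
    have "(transpose (F Y) *v gradient p x) = (\<chi> I. q I Y)"
      using q[OF Y(1)] Y(2) by (simp add: vec_eq_iff matrix_vector_mult_def transpose_def)
    then have "(V Y ** V Y) *v gradient p x = F Y *v (\<chi> I. q I Y)"
      by (simp add: VV[OF Y(1)] matrix_vector_mul_assoc[symmetric])
    then show ?thesis
      by (simp add: Let_def \<psi>_def[symmetric] Y_def[symmetric] matrix_vector_mult_def
          sum_distrib_left mult.assoc)
  qed
  define J0 where "J0 = J X"
  have J0: "J0 > 0" using assms(6)[OF X] by (simp add: J0_def)
  have "partial_deriv i (\<lambda>x. ?u x $ i) (chi X) = (\<Sum>I\<in>UNIV.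
      (inverse J0 * F X $ i $ I) * q' I (G *v axis i 1) + c' i I (G *v axis i 1) * q I X)" for i
  \<comment> \<open>The product rule is applied in the variable \<open>X\<close>; composing with
    \<open>\<psi>\<close>, whose derivative is \<open>G\<close>, turns coordinate directions in
    \<open>x\<close> into \<open>G *v axis i 1\<close>.\<close>
  proof (rule partial_deriv_eqI)
    have "((\<lambda>Y. \<Sum>I\<in>UNIV. (inverse (J Y) * F Y $ i $ I) * q I Y) has_derivative
      (\<lambda>w. \<Sum>I\<in>UNIV. (inverse J0 * F X $ i $ I) * q' I w + c' i I w * q I X)) (at (\<psi> (chi X)))"
      unfolding \<psi>_chi[OF X] J0_def by (intro has_derivative_sum has_derivative_mult dc q')
    from has_derivative_compose[OF d\<psi> this]
    show "((\<lambda>x. ?u x $ i) has_derivative (\<lambda>w. \<Sum>I\<in>UNIV.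
      (inverse J0 * F X $ i $ I) * q' I (G *v w) + c' i I (G *v w) * q I X)) (at (chi X))"
      by (rule has_derivative_transform_within_open[OF _ T chi_in[OF X]]) (simp only: u)
  qed
  then have "divergence ?u (chi X) = (\<Sum>i\<in>UNIV. \<Sum>I\<in>UNIV.
      (inverse J0 * F X $ i $ I) * q' I (G *v axis i 1) + c' i I (G *v axis i 1) * q I X)"
    by (simp only: divergence_def)
  also have "\<dots> = (\<Sum>I\<in>UNIV. \<Sum>i\<in>UNIV.
      (inverse J0 * F X $ i $ I) * q' I (G *v axis i 1) + c' i I (G *v axis i 1) * q I X)"
    by (rule sum.swap)
  \<comment> \<open>For fixed \<open>I\<close> the factor \<open>q I X\<close> comes out of the sum
    of the \<open>c'\<close> terms, which vanishes by the Piola identity; the other terms collapse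
    by the chain rule.\<close>
  also have "\<dots> = (\<Sum>I\<in>UNIV. inverse J0 * q' I (axis I 1))"
  proof (rule sum.cong[OF refl])
    fix I
    have "q' I (axis I 1) = (\<Sum>i\<in>UNIV. F X $ i $ I * q' I (G *v axis i 1))"
      using sum_linear_left_inverse[OF has_derivative_linear[OF q'] GF, of I I]
      by (simp only: real_scaleR_def)
    then show "(\<Sum>i\<in>UNIV. (inverse J0 * F X $ i $ I) * q' I (G *v axis i 1)
        + c' i I (G *v axis i 1) * q I X) = inverse J0 * q' I (axis I 1)"
      using c'(2)[of I]
      by (simp add: sum.distrib mult.assoc sum_distrib_left[symmetric] sum_distrib_right[symmetric])
  qed
  also have "\<dots> = inverse J0 * laplacian (p \<circ> chi) X"
    using partial_deriv_eqI[OF q'] by (simp add: laplacian_def q_def sum_distrib_left)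
  finally show ?thesis
    using J0 by (simp add: J0_def)
qed

end
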